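(* Let $\Gamma$ be a strongly regular graph. Then for every integer $\ell>1$, $\Gamma$ is a strongly $\ell$-walk-regular graph with parameters $(\lambda_\ell,\mu_\ell,\nu_\ell)$ for some $\lambda_\ell,\mu_\ell,\nu_\ell$.
   Context: Graphs are finite, simple and undirected. A strongly regular graph is a regular graph (not necessarily connected) in which the number of common neighbors of two distinct vertices depends only on whether these vertices are adjacent or not. For an integer $\ell>1$, a graph $\Gamma$ is strongly $\ell$-walk-regular with parameters $(\lambda_\ell,\mu_\ell,\nu_\ell)$ if the number of walks of length $\ell$ between two vertices is $\lambda_\ell$ for every two adjacent vertices, $\mu_\ell$ for every two distinct non-adjacent vertices, and $\nu_\ell$ for every two identical vertices (i.e. from each vertex to itself). *)

theory Defs
  imports "Graph_Theory.Arc_Walk"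
begin

text \<open>
  The locale \<open>graph\<close> models a finite simple undirected graph as a finite symmetric digraph without
  loops or parallel arcs: every edge is represented by two opposite arcs. Hence the degree of a
  vertex is its \<open>out_degree\<close>, and distinct walks have distinct arc lists.
  Isolated vertices, disconnected graphs, complete graphs and edgeless graphs are all allowed.
\<close>

definition regular :: "('a, 'b) pre_digraph \<Rightarrow> bool" where
  "regular G \<longleftrightarrow> (\<exists>k. \<forall>v \<in> verts G. out_degree G v = k)"

definition common_neighbors :: "('a, 'b) pre_digraph \<Rightarrow> 'a \<Rightarrow> 'a \<Rightarrow> 'a set" where
  "common_neighbors G u v = {w \<in> verts G. u \<rightarrow>\<^bsub>G\<^esub> w \<and> v \<rightarrow>\<^bsub>G\<^esub> w}"

definition strongly_regular :: "('a, 'b) pre_digraph \<Rightarrow> bool" where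
  "strongly_regular G \<longleftrightarrow> graph G \<and> regular G \<and>
    (\<exists>a. \<forall>u \<in> verts G. \<forall>v \<in> verts G. u \<noteq> v \<and> u \<rightarrow>\<^bsub>G\<^esub> v \<longrightarrow>
       card (common_neighbors G u v) = a) \<and>
    (\<exists>c. \<forall>u \<in> verts G. \<forall>v \<in> verts G. u \<noteq> v \<and> \<not> u \<rightarrow>\<^bsub>G\<^esub> v \<longrightarrow>
       card (common_neighbors G u v) = c)"

definition walks_of_length :: "('a, 'b) pre_digraph \<Rightarrow> nat \<Rightarrow> 'a \<Rightarrow> 'a \<Rightarrow> 'b awalk set" where
  "walks_of_length G l u v = {p. pre_digraph.awalk G u p v \<and> length p = l}"

text \<open>
  If \<open>G\<close> has no pair of vertices of one of the three kinds, then the corresponding parameter is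
  unconstrained.
\<close>

definition strongly_walk_regular ::
  "('a, 'b) pre_digraph \<Rightarrow> nat \<Rightarrow> nat \<Rightarrow> nat \<Rightarrow> nat \<Rightarrow> bool" where
  "strongly_walk_regular G l lam mu nu \<longleftrightarrow> l > 1 \<and> graph G \<and>
    (\<forall>u \<in> verts G. \<forall>v \<in> verts G. u \<rightarrow>\<^bsub>G\<^esub> v \<longrightarrow>
       card (walks_of_length G l u v) = lam) \<and>
    (\<forall>u \<in> verts G. \<forall>v \<in> verts G. u \<noteq> v \<and> \<not> u \<rightarrow>\<^bsub>G\<^esub> v \<longrightarrow>
       card (walks_of_length G l u v) = mu) \<and>
    (\<forall>u \<in> verts G. card (walks_of_length G l u u) = nu)"

end

theory Submission
  imports Defs
begin

text \<open>
  By induction on \<open>l\<close>, the number of walks of length \<open>l\<close> from \<open>u\<close> to \<open>v\<close> depends only on whether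
  \<open>u\<close> and \<open>v\<close> are equal, adjacent or neither: splitting off the first step sums these numbers
  over the neighbors \<open>w\<close> of \<open>u\<close>, and strong regularity fixes how many \<open>w\<close> stand in each of the
  three relations to \<open>v\<close>.
\<close>

context graph
begin

lemma head_image_out_arcs: "head G ` out_arcs G u = {w. u \<rightarrow>\<^bsub>G\<^esub> w}"
  by (force simp: out_arcs_def arcs_ends_conv image_iff)

text \<open>Two arcs with the same tail and the same head would be parallel. This allows sums over
  out-arcs to be rewritten as sums over neighbors.\<close>

lemma inj_on_head_out_arcs: "inj_on (head G) (out_arcs G u)"
  by (auto intro!: inj_onI no_multi_arcs simp: arc_to_ends_def)

lemma walks_of_length_0:
  "u \<in> verts G \<Longrightarrow> walks_of_length G 0 u v = (if u = v then {[]} else {})"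
  by (auto simp: walks_of_length_def awalk_Nil_iff)

lemma walks_of_length_Suc:
  "walks_of_length G (Suc l) u v =
     (\<Union>e\<in>out_arcs G u. (#) e ` walks_of_length G l (head G e) v)"
proof (rule set_eqI)
  fix p
  show "p \<in> walks_of_length G (Suc l) u v \<longleftrightarrow>
      p \<in> (\<Union>e\<in>out_arcs G u. (#) e ` walks_of_length G l (head G e) v)"
    by (cases p) (auto simp: walks_of_length_def awalk_Cons_iff)
qed

lemma finite_walks_of_length: "u \<in> verts G \<Longrightarrow> finite (walks_of_length G l u v)"
  by (induction l arbitrary: u) (auto simp: walks_of_length_0 walks_of_length_Suc)

text \<open>Entrywise form of A^(l+1) = A * A^l for the adjacency matrix A.\<close>

lemma card_walks_of_length_Suc:
  "card (walks_of_length G (Suc l) u v) =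
     (\<Sum>w | u \<rightarrow>\<^bsub>G\<^esub> w. card (walks_of_length G l w v))"
proof -
  have "card (walks_of_length G (Suc l) u v) =
      (\<Sum>e\<in>out_arcs G u. card ((#) e ` walks_of_length G l (head G e) v))"
    unfolding walks_of_length_Suc
    \<comment> \<open>The pieces are disjoint because walks from different pieces differ in their
      first arc.\<close>
    by (rule card_UN_disjoint) (auto intro!: finite_imageI finite_walks_of_length head_in_verts)
  also have "\<dots> = (\<Sum>e\<in>out_arcs G u. card (walks_of_length G l (head G e) v))"
    by (simp add: card_image)
  also have "\<dots> = (\<Sum>w | u \<rightarrow>\<^bsub>G\<^esub> w. card (walks_of_length G l w v))"
    unfolding head_image_out_arcs[symmetric]
    by (simp add: sum.reindex[OF inj_on_head_out_arcs])
  finally show ?thesis .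
qed

lemma card_adjacent: "card {w. u \<rightarrow>\<^bsub>G\<^esub> w} = out_degree G u"
  by (metis card_image head_image_out_arcs inj_on_head_out_arcs out_degree_def)

lemma finite_adjacent: "finite {w. u \<rightarrow>\<^bsub>G\<^esub> w}"
  by (metis finite_imageI finite_out_arcs head_image_out_arcs)

lemma not_adjacent_self: "\<not> u \<rightarrow>\<^bsub>G\<^esub> u"
  using adj_not_same by blast

lemma adjacent_commute: "u \<rightarrow>\<^bsub>G\<^esub> v \<longleftrightarrow> v \<rightarrow>\<^bsub>G\<^esub> u"
  using arcs_ends_symmetric[OF sym_arcs] by blast

text \<open>The truncated subtractions are harmless: the subtracted vertices are all neighbors of \<open>u\<close>.\<close>

lemma sum_adjacent_by_relation:
  fixes lam mu nu :: nat
  shows "(\<Sum>w | u \<rightarrow>\<^bsub>G\<^esub> w. if w = v then nu else if w \<rightarrow>\<^bsub>G\<^esub> v then lam else mu) =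
    (if u \<rightarrow>\<^bsub>G\<^esub> v then nu else 0) + card (common_neighbors G u v) * lam +
    (out_degree G u - (if u \<rightarrow>\<^bsub>G\<^esub> v then 1 else 0) - card (common_neighbors G u v)) * mu"
proof -
  let ?N = "{w. u \<rightarrow>\<^bsub>G\<^esub> w}"
  let ?f = "\<lambda>w. if w = v then nu else if w \<rightarrow>\<^bsub>G\<^esub> v then lam else mu"
  let ?C = "common_neighbors G u v"
  have C: "?C = {w \<in> ?N. w \<rightarrow>\<^bsub>G\<^esub> v}"
    by (auto simp: common_neighbors_def adjacent_commute[of v])
  \<comment> \<open>Since there are no loops, \<open>v\<close> is not in \<open>?C\<close>. So
    \<open>?N\<close> splits into \<open>v\<close> itself (if it is a neighbor of \<open>u\<close>),
    \<open>?C\<close> and the rest, and \<open>?f\<close> is constant on each part.\<close>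
  have CN: "?C \<subseteq> ?N - {v}"
    using C not_adjacent_self by auto
  have fin: "finite (?N - {v})" "finite ?N"
    using finite_adjacent by auto
  have "sum ?f (?N - {v}) = sum ?f ?C + sum ?f (?N - {v} - ?C)"
    using sum.subset_diff[OF CN fin(1), of ?f] by simp
  also have "sum ?f ?C = (\<Sum>w\<in>?C. lam)"
    by (rule sum.cong) (use C CN in auto)
  also have "sum ?f (?N - {v} - ?C) = (\<Sum>w\<in>?N - {v} - ?C. mu)"
    by (rule sum.cong) (auto simp: C)
  \<comment> \<open>Removing \<open>v\<close> lowers the cardinality of \<open>?N\<close> by one
    exactly when \<open>v\<close> is a neighbor of \<open>u\<close>.\<close>
  also have "(\<Sum>w\<in>?N - {v} - ?C. mu) =
      (out_degree G u - (if u \<rightarrow>\<^bsub>G\<^esub> v then 1 else 0) - card ?C) * mu"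
    using CN fin finite_subset[OF CN fin(1)]
    by (simp add: card_Diff_subset card_adjacent card_Diff_singleton_if)
  finally have "sum ?f (?N - {v}) = card ?C * lam +
      (out_degree G u - (if u \<rightarrow>\<^bsub>G\<^esub> v then 1 else 0) - card ?C) * mu"
    by simp
  moreover have "sum ?f ?N = (if u \<rightarrow>\<^bsub>G\<^esub> v then nu else 0) + sum ?f (?N - {v})"
    using sum.remove[OF fin(2), of v ?f] by (cases "u \<rightarrow>\<^bsub>G\<^esub> v") auto
  ultimately show ?thesis by simp
qed

text \<open>Serves the diagonal case of the induction, which strong regularity leaves open.\<close>

lemma card_common_neighbors_self: "card (common_neighbors G u u) = out_degree G u"
proof -
  have "common_neighbors G u u = {w. u \<rightarrow>\<^bsub>G\<^esub> w}"
    by (auto simp: common_neighbors_def)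
  then show ?thesis by (simp add: card_adjacent)
qed

lemma card_walks_of_length_by_relation:
  assumes deg: "\<And>v. v \<in> verts G \<Longrightarrow> out_degree G v = k"
    and adj: "\<And>u v. u \<rightarrow>\<^bsub>G\<^esub> v \<Longrightarrow> card (common_neighbors G u v) = a"
    and nonadj: "\<And>u v. \<lbrakk>u \<in> verts G; v \<in> verts G; u \<noteq> v; \<not> u \<rightarrow>\<^bsub>G\<^esub> v\<rbrakk>
      \<Longrightarrow> card (common_neighbors G u v) = c"
  shows "\<exists>lam mu nu. \<forall>u\<in>verts G. \<forall>v\<in>verts G. card (walks_of_length G l u v) =
    (if u = v then nu else if u \<rightarrow>\<^bsub>G\<^esub> v then lam else mu)"
proof (induction l)
  case 0
  show ?case
    \<comment> \<open>The empty walk is the only walk of length 0, so the induction starts from the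
      identity matrix.\<close>
    by (rule exI[of _ 0], rule exI[of _ 0], rule exI[of _ 1]) (auto simp: walks_of_length_0)
next
  case (Suc l)
  then obtain lam mu nu where IH: "\<And>u v. \<lbrakk>u \<in> verts G; v \<in> verts G\<rbrakk> \<Longrightarrow>
      card (walks_of_length G l u v) = (if u = v then nu else if u \<rightarrow>\<^bsub>G\<^esub> v then lam else mu)"
    by blast
  have step: "card (walks_of_length G (Suc l) u v) =
      (if u \<rightarrow>\<^bsub>G\<^esub> v then nu else 0) + card (common_neighbors G u v) * lam +
      (k - (if u \<rightarrow>\<^bsub>G\<^esub> v then 1 else 0) - card (common_neighbors G u v)) * mu"
    if "u \<in> verts G" "v \<in> verts G" for u v
  proof -
    have "card (walks_of_length G (Suc l) u v) =
        (\<Sum>w | u \<rightarrow>\<^bsub>G\<^esub> w. if w = v then nu else if w \<rightarrow>\<^bsub>G\<^esub> v then lam else mu)"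
      unfolding card_walks_of_length_Suc by (rule sum.cong) (use IH that in auto)
    then show ?thesis
      by (simp only: sum_adjacent_by_relation deg[OF that(1)])
  qed
  show ?case
    \<comment> \<open>The witnesses are the right-hand side of \<open>step\<close> for adjacent,
      distinct non-adjacent and equal vertices. In the last case all \<open>k\<close> neighbors of
      \<open>u\<close> are common neighbors, so the factor of \<open>mu\<close> is k - 0 - k =
      0.\<close>
    by (rule exI[of _ "nu + a * lam + (k - 1 - a) * mu"],
        rule exI[of _ "c * lam + (k - c) * mu"], rule exI[of _ "k * lam"])
      (auto simp: step adj nonadj card_common_neighbors_self deg not_adjacent_self)
qed

end

theorem proposition2p2:
  fixes G :: "('a, 'b) pre_digraph"
  assumes "strongly_regular G"
  shows "\<forall>l > 1. \<exists>lam mu nu. strongly_walk_regular G l lam mu nu"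
proof (intro allI impI)
  fix l :: nat
  assume l: "l > 1"
  from assms interpret graph G
    by (simp add: strongly_regular_def)
  from assms obtain k a c where
    deg: "\<forall>v\<in>verts G. out_degree G v = k" and
    adj: "\<forall>u\<in>verts G. \<forall>v\<in>verts G. u \<noteq> v \<and> u \<rightarrow>\<^bsub>G\<^esub> v \<longrightarrow> card (common_neighbors G u v) = a" and
    nonadj: "\<forall>u\<in>verts G. \<forall>v\<in>verts G. u \<noteq> v \<and> \<not> u \<rightarrow>\<^bsub>G\<^esub> v \<longrightarrow> card (common_neighbors G u v) = c"
    unfolding strongly_regular_def regular_def by (elim conjE exE)
  have "card (common_neighbors G u v) = a" if "u \<rightarrow>\<^bsub>G\<^esub> v" for u v
    using adj adj_in_verts[OF that] not_adjacent_self that by metis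
  then obtain lam mu nu where "\<forall>u\<in>verts G. \<forall>v\<in>verts G. card (walks_of_length G l u v) =
      (if u = v then nu else if u \<rightarrow>\<^bsub>G\<^esub> v then lam else mu)"
    using card_walks_of_length_by_relation[of k a c l] deg nonadj by auto
  \<comment> \<open>The adjacent case of the definition does not state that the vertices are
    distinct; the absence of loops supplies this.\<close>
  then have "strongly_walk_regular G l lam mu nu"
    using l graph_axioms not_adjacent_self by (auto simp: strongly_walk_regular_def)
  then show "\<exists>lam mu nu. strongly_walk_regular G l lam mu nu"
    by blast
qed

end
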